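(* Let $f:\mathbb{N}\to[0,\infty)$ be non-increasing with $\sum_{n=1}^\infty f(n)=\infty$, and let $\mathcal{I}_f=\{A\subseteq\mathbb{N}\mid \sum_{n\in A}f(n)<\infty\}$. Then there exists an $\mathcal{I}_f$-TAD family $\mathcal{A}$ of the cardinality of the continuum. In consequence, there exists an abstract upper density $\delta$ that is translation invariant and rich, and such that $\mathcal{Z}_\delta=\mathcal{I}_f$.
   Context: $\mathbb{N}$ is the set of positive integers. For $A\subseteq\mathbb{N}$ and $k\in\mathbb{Z}$, $A+k:=\{a+k\mid a\in A,\ a+k\in\mathbb{N}\}$. For an ideal $\mathcal{I}$ (a nonempty family of subsets of $\mathbb{N}$, not containing $\mathbb{N}$, closed under subsets and finite unions), two sets $A,B\subseteq\mathbb{N}$ are $\mathcal{I}$-TAD if $(A+s)\cap(B+t)\in\mathcal{I}$ for all $s,t\in\mathbb{Z}$; a family $\mathcal{A}$ is $\mathcal{I}$-TAD if $\mathcal{A}\cap\mathcal{I}=\emptyset$, its members are infinite, and any two distinct members are $\mathcal{I}$-TAD. An abstract upper density is a function $\delta:\mathcal{P}(\mathbb{N})\to[0,1]$ with $\delta(\mathbb{N})=1$, $\delta(F)=0$ for all finite $F$, $\delta(A)\le\delta(B)$ whenever $A\subseteq B$, and $\delta(A\cup B)\le\delta(A)+\delta(B)$. It is translation invariant if $\delta(A+m)=\delta(A-m)=\delta(A)$ for all $A\subseteq\mathbb{N}$, $m\in\mathbb{N}$ (where $A-m=\{k\in\mathbb{N}\mid k+m\in A\}$), and rich if every $r\in[0,1]$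 equals $\delta(A)$ for some $A\subseteq\mathbb{N}$. $\mathcal{Z}_\delta:=\{A\subseteq\mathbb{N}\mid\delta(A)=0\}$. *)

theory Defs
  imports "HOL-Analysis.Analysis" "HOL-Library.Equipollence"
begin

text \<open>The natural numbers start at 1 here; their set is rendered as the subset
  \<^term>\<open>{1::nat..}\<close> of the type \<^typ>\<open>nat\<close>, to which every notion below is relativised.\<close>

abbreviation PN :: "nat set" where
  "PN \<equiv> {1..}"

definition translate :: "nat set \<Rightarrow> int \<Rightarrow> nat set" where
  "translate A k = {n \<in> PN. \<exists>a\<in>A. int n = int a + k}"

definition ideal_on_PN :: "nat set set \<Rightarrow> bool" where
  "ideal_on_PN I \<longleftrightarrow>
     I \<subseteq> Pow PN \<and> I \<noteq> {} \<and> PN \<notin> I \<and>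
     (\<forall>A\<in>I. \<forall>B. B \<subseteq> A \<longrightarrow> B \<in> I) \<and>
     (\<forall>A\<in>I. \<forall>B\<in>I. A \<union> B \<in> I)"

definition TAD :: "nat set set \<Rightarrow> nat set \<Rightarrow> nat set \<Rightarrow> bool" where
  "TAD I A B \<longleftrightarrow> (\<forall>s t :: int. translate A s \<inter> translate B t \<in> I)"

definition TAD_family :: "nat set set \<Rightarrow> nat set set \<Rightarrow> bool" where
  "TAD_family I \<A> \<longleftrightarrow>
     \<A> \<subseteq> Pow PN \<and> \<A> \<inter> I = {} \<and> (\<forall>A\<in>\<A>. infinite A) \<and>
     (\<forall>A\<in>\<A>. \<forall>B\<in>\<A>. A \<noteq> B \<longrightarrow> TAD I A B)"

definition abstract_upper_density :: "(nat set \<Rightarrow> real) \<Rightarrow> bool" where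
  "abstract_upper_density \<delta> \<longleftrightarrow>
     (\<forall>A. A \<subseteq> PN \<longrightarrow> \<delta> A \<in> {0..1}) \<and>
     \<delta> PN = 1 \<and>
     (\<forall>F. F \<subseteq> PN \<longrightarrow> finite F \<longrightarrow> \<delta> F = 0) \<and>
     (\<forall>A B. A \<subseteq> B \<longrightarrow> B \<subseteq> PN \<longrightarrow> \<delta> A \<le> \<delta> B) \<and>
     (\<forall>A B. A \<subseteq> PN \<longrightarrow> B \<subseteq> PN \<longrightarrow> \<delta> (A \<union> B) \<le> \<delta> A + \<delta> B)"

definition translation_invariant :: "(nat set \<Rightarrow> real) \<Rightarrow> bool" where
  "translation_invariant \<delta> \<longleftrightarrow>
     (\<forall>A m. A \<subseteq> PN \<longrightarrow> m \<in> PN \<longrightarrow>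
        \<delta> (translate A (int m)) = \<delta> A \<and> \<delta> {k \<in> PN. k + m \<in> A} = \<delta> A)"

definition rich :: "(nat set \<Rightarrow> real) \<Rightarrow> bool" where
  "rich \<delta> \<longleftrightarrow> (\<forall>r\<in>{0..1}. \<exists>A. A \<subseteq> PN \<and> \<delta> A = r)"

definition zero_ideal :: "(nat set \<Rightarrow> real) \<Rightarrow> nat set set" where
  "zero_ideal \<delta> = {A. A \<subseteq> PN \<and> \<delta> A = 0}"

text \<open>Only used for functions that are nonnegative on \<^term>\<open>PN\<close>, where
  unconditional summability over a set says that the sum over that set is finite.\<close>

definition summable_ideal :: "(nat \<Rightarrow> real) \<Rightarrow> nat set set" where
  "summable_ideal f = {A. A \<subseteq> PN \<and> f summable_on A}"

lemma ideal_summable_ideal: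
  assumes "\<not> f summable_on PN"
  shows "ideal_on_PN (summable_ideal f)"
proof -
  have "f summable_on B" if "f summable_on A" "B \<subseteq> A" for A B
    using that by (rule summable_on_subset_banach)
  moreover have "f summable_on (A \<union> B)" if "f summable_on A" "f summable_on B" for A B
    using that by (rule summable_on_union)
  moreover have "{} \<in> summable_ideal f"
    by (simp add: summable_ideal_def)
  ultimately show ?thesis
    using assms unfolding ideal_on_PN_def summable_ideal_def by blast
qed

lemma translate_uminus: "translate A (- int m) = {k \<in> PN. k + m \<in> A}"
proof -
  have "int n = int a + - int m \<longleftrightarrow> a = n + m" for n a by auto
  then show ?thesis unfolding translate_def by (simp only: bex_simps) auto
qed

end

theory Submission
  imports Defs
begin

text \<open>
  Choose consecutive finite blocks, the \<open>m\<close>-th one an arithmetic progression of step \<open>m + 1\<close> whose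
  \<open>f\<close>-mass is at least 1; monotonicity of \<open>f\<close> makes the mass along every infinite progression
  infinite. Since the gaps in the union of the blocks tend to infinity, translates of two unions of
  blocks meet in a finite set as soon as the two index sets do. Continuum many pairwise almost
  disjoint infinite index sets then give the family.

  For the density, write the family as \<open>A q\<close> with \<open>q\<close> real and let \<open>I\<^sub>r\<close> be the ideal
  generated by \<open>I\<close> and the translates of the \<open>A q\<close> with \<open>0 < q \<le> r\<close>. The value at \<open>X\<close> is the
  infimum of all \<open>r < 1\<close> with \<open>X \<in> I\<^sub>r\<close>, or 1 if there is none. It turns unions into maxima,
  and \<open>A r\<close> has value \<open>r\<close>. It vanishes only on \<open>I\<close>: a set covered modulo \<open>I\<close> by translates of
  finitely many \<open>A q\<close>, and also by translates of other \<open>A q\<close> with smaller indices, lies in \<open>I\<close>.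
\<close>

section \<open>An almost disjoint family of the size of the continuum\<close>

definition initial_segment_code :: "nat set \<Rightarrow> nat \<Rightarrow> nat" where
  "initial_segment_code S n = prod_encode (n, set_encode (S \<inter> {..<n}))"

lemma initial_segment_code_eq_iff:
  "initial_segment_code S m = initial_segment_code T n \<longleftrightarrow> m = n \<and> S \<inter> {..<m} = T \<inter> {..<n}"
  by (simp add: initial_segment_code_def prod_encode_eq set_encode_eq)

definition branch :: "nat set \<Rightarrow> nat set" where
  "branch S = range (initial_segment_code S)"

lemma infinite_branch: "infinite (branch S)"
  unfolding branch_def
  by (intro range_inj_infinite injI) (simp add: initial_segment_code_eq_iff)

lemma finite_branch_Int:
  assumes "S \<noteq> T"
  shows "finite (branch S \<inter> branch T)"
proof -
  obtain k where k: "\<not> (k \<in> S \<longleftrightarrow> k \<in> T)" using assms by blast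
  have "branch S \<inter> branch T \<subseteq> initial_segment_code S ` {..k}"
  proof
    fix x assume "x \<in> branch S \<inter> branch T"
    then obtain n where x: "x = initial_segment_code S n" and "S \<inter> {..<n} = T \<inter> {..<n}"
      unfolding branch_def by (auto simp: initial_segment_code_eq_iff)
    then have "\<not> k < n" using k by blast
    then show "x \<in> initial_segment_code S ` {..k}" using x by simp
  qed
  then show ?thesis by (rule finite_subset) simp
qed

section \<open>Translates and ideals\<close>

lemma translate_subset_PN: "translate A k \<subseteq> PN"
  by (auto simp: translate_def)

lemma translate_mono: "A \<subseteq> B \<Longrightarrow> translate A k \<subseteq> translate B k"
  by (auto simp: translate_def)

lemma translate_Un: "translate (A \<union> B) k = translate A k \<union> translate B k"
  by (auto simp: translate_def)

lemma translate_Union: "translate (\<Union>\<A>) k = (\<Union>A\<in>\<A>. translate A k)"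
  by (auto simp: translate_def)

lemma translate_0: "A \<subseteq> PN \<Longrightarrow> translate A 0 = A"
  by (auto simp: translate_def)

lemma translate_int: "A \<subseteq> PN \<Longrightarrow> translate A (int m) = (\<lambda>n. n + m) ` A"
  by (force simp: translate_def image_iff simp flip: of_nat_add)

lemma translate_translate_subset: "translate (translate A s) t \<subseteq> translate A (s + t)"
  unfolding translate_def by force

lemma subset_translate_translate_uminus:
  assumes "A \<subseteq> PN"
  shows "A \<subseteq> translate (translate A k) (- k) \<union> {1..nat \<bar>k\<bar>}"
proof
  fix n assume n: "n \<in> A"
  show "n \<in> translate (translate A k) (- k) \<union> {1..nat \<bar>k\<bar>}"
  proof (cases "0 < int n + k")
    case True
    then have "nat (int n + k) \<in> translate A k"
      unfolding translate_def using n by force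
    moreover have "int n = int (nat (int n + k)) + - k" using True by simp
    ultimately show ?thesis unfolding translate_def using n assms by blast
  next
    case False
    then show ?thesis using n assms by auto
  qed
qed

lemma finite_translate:
  assumes "finite A"
  shows "finite (translate A k)"
proof (rule finite_subset)
  show "translate A k \<subseteq> (\<lambda>a. nat (int a + k)) ` A"
    by (force simp: translate_def)
  show "finite ((\<lambda>a. nat (int a + k)) ` A)" using assms by simp
qed

locale admissible_ideal =
  fixes I :: "nat set set"
  assumes ideal: "ideal_on_PN I"
    and finite_mem: "finite X \<Longrightarrow> X \<subseteq> PN \<Longrightarrow> X \<in> I"
begin

lemma mem_subset_PN: "X \<in> I \<Longrightarrow> X \<subseteq> PN"
  using ideal unfolding ideal_on_PN_def by blast

lemma PN_notin: "PN \<notin> I"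
  using ideal unfolding ideal_on_PN_def by blast

lemma mem_subset: "X \<in> I \<Longrightarrow> Y \<subseteq> X \<Longrightarrow> Y \<in> I"
  using ideal unfolding ideal_on_PN_def by blast

lemma mem_Un: "X \<in> I \<Longrightarrow> Y \<in> I \<Longrightarrow> X \<union> Y \<in> I"
  using ideal unfolding ideal_on_PN_def by blast

lemma mem_UN: "finite F \<Longrightarrow> (\<And>x. x \<in> F \<Longrightarrow> g x \<in> I) \<Longrightarrow> (\<Union>x\<in>F. g x) \<in> I"
  by (induction F rule: finite_induct) (auto intro: mem_Un finite_mem)

lemma TAD_imp_Int_mem:
  assumes "TAD I A B" "A \<subseteq> PN" "B \<subseteq> PN"
  shows "A \<inter> B \<in> I"
  using assms translate_0 unfolding TAD_def by metis

lemma TAD_if_finite: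
  assumes "\<And>s t. finite (translate A s \<inter> translate B t)"
  shows "TAD I A B"
  unfolding TAD_def using assms translate_subset_PN by (blast intro: finite_mem)

end

locale translation_invariant_ideal = admissible_ideal +
  assumes translate_mem: "X \<in> I \<Longrightarrow> translate X k \<in> I"
begin

lemma translate_mem_iff:
  assumes "X \<subseteq> PN"
  shows "translate X k \<in> I \<longleftrightarrow> X \<in> I"
proof
  assume "translate X k \<in> I"
  then have "translate (translate X k) (- k) \<union> {1..nat \<bar>k\<bar>} \<in> I"
    by (rule mem_Un [OF translate_mem finite_mem]) auto
  then show "X \<in> I"
    using subset_translate_translate_uminus [OF assms] by (rule mem_subset)
qed (rule translate_mem)

end

section \<open>Sparse blocks\<close>

locale sparse_blocks =
  fixes F :: "nat \<Rightarrow> nat set"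
  assumes finite_block: "finite (F i)"
    and block_subset_PN: "F i \<subseteq> PN"
    and disjoint_blocks: "disjoint_family F"
    and block_gap: "x \<in> F i \<Longrightarrow> y \<in> F j \<Longrightarrow> x < y \<Longrightarrow> x + i < y"
begin

lemma block_index_less_dist:
  assumes "x \<in> F i" "y \<in> F j" "i \<noteq> j"
  shows "int i < \<bar>int x - int y\<bar> \<or> int j < \<bar>int x - int y\<bar>"
proof (cases x y rule: linorder_cases)
  case equal
  then show ?thesis using disjoint_family_onD [OF disjoint_blocks] assms by blast
next
  case less
  then show ?thesis using block_gap [OF assms(1,2)] by linarith
next
  case greater
  then show ?thesis using block_gap [OF assms(2,1)] by linarith
qed

lemma finite_translate_Int_Union_blocks:
  assumes "finite (X \<inter> Y)"
  shows "finite (translate (\<Union>(F ` X)) s \<inter> translate (\<Union>(F ` Y)) t)"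
proof -
  define G where "G = \<Union>(F ` (X \<inter> Y \<union> {..<nat \<bar>s - t\<bar>}))"
  have "translate (\<Union>(F ` X)) s \<inter> translate (\<Union>(F ` Y)) t \<subseteq> translate G s \<union> translate G t"
  proof
    fix n assume "n \<in> translate (\<Union>(F ` X)) s \<inter> translate (\<Union>(F ` Y)) t"
    then obtain x y i j where "n \<in> PN"
      and x: "i \<in> X" "x \<in> F i" "int n = int x + s" and y: "j \<in> Y" "y \<in> F j" "int n = int y + t"
      unfolding translate_def by blast
    have "\<bar>int x - int y\<bar> = \<bar>s - t\<bar>" using x(3) y(3) by linarith
    then consider "i = j" | "i < nat \<bar>s - t\<bar>" | "j < nat \<bar>s - t\<bar>"
      using block_index_less_dist [OF x(2) y(2)] by linarith
    then have "x \<in> G \<or> y \<in> G" using x y by cases (auto simp: G_def)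
    then show "n \<in> translate G s \<union> translate G t"
      using \<open>n \<in> PN\<close> x y unfolding translate_def by blast
  qed
  moreover have "finite G" using assms finite_block by (simp add: G_def)
  ultimately show ?thesis using finite_subset finite_translate finite_UnI by metis
qed

end

lemma (in admissible_ideal) ex_continuum_TAD_family:
  assumes "sparse_blocks F" and large: "\<And>X. infinite X \<Longrightarrow> \<Union>(F ` X) \<notin> I"
  shows "\<exists>\<A>. TAD_family I \<A> \<and> \<A> \<approx> (UNIV :: real set)"
proof -
  interpret sparse_blocks F by fact
  define A where "A S = \<Union>(F ` branch S)" for S
  have subset: "A S \<subseteq> PN" for S using block_subset_PN by (auto simp: A_def)
  have notin: "A S \<notin> I" for S unfolding A_def by (rule large [OF infinite_branch])
  have TAD: "TAD I (A S) (A T)" if "S \<noteq> T" for S T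
    unfolding A_def
    by (intro TAD_if_finite finite_translate_Int_Union_blocks finite_branch_Int that)
  have "inj A"
  proof (rule injI, rule ccontr)
    fix S T assume "A S = A T" "S \<noteq> T"
    then have "A S \<inter> A S \<in> I" using TAD_imp_Int_mem [OF TAD] subset by metis
    then show False using notin by simp
  qed
  then have "range A \<approx> (UNIV :: nat set set)" by (rule inj_on_image_eqpoll_self)
  then have "range A \<approx> (UNIV :: real set)" using nat_sets_eqpoll_reals by (rule eqpoll_trans)
  moreover have "infinite (A S)" for S using notin subset finite_mem by blast
  then have "TAD_family I (range A)"
    unfolding TAD_family_def using subset notin by (auto intro: TAD)
  ultimately show ?thesis by blast
qed

definition arith_progression :: "nat \<Rightarrow> nat \<Rightarrow> nat \<Rightarrow> nat set" where
  "arith_progression a d n = (\<lambda>j. a + j * d) ` {..<n}"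

lemma finite_arith_progression: "finite (arith_progression a d n)"
  by (simp add: arith_progression_def)

lemma arith_progression_ge: "x \<in> arith_progression a d n \<Longrightarrow> a \<le> x"
  by (auto simp: arith_progression_def)

lemma arith_progression_add_step_le:
  assumes "x \<in> arith_progression a d n"
  shows "x + d \<le> a + n * d"
proof -
  obtain j where j: "j < n" "x = a + j * d" using assms by (auto simp: arith_progression_def)
  then have "Suc j * d \<le> n * d" by (intro mult_le_mono1) simp
  then show ?thesis using j by simp
qed

lemma arith_progression_gap:
  assumes "x \<in> arith_progression a d n" "y \<in> arith_progression a d n" "x < y"
  shows "x + d \<le> y"
proof -
  obtain i j where ij: "x = a + i * d" "y = a + j * d"
    using assms by (auto simp: arith_progression_def)
  then have "i < j" using assms(3) by simp
  then have "Suc i * d \<le> j * d" by (intro mult_le_mono1) simp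
  then show ?thesis using ij by simp
qed

lemma sum_arith_progression:
  assumes "0 < d"
  shows "sum f (arith_progression a d n) = (\<Sum>j<n. f (a + j * d))"
  unfolding arith_progression_def using assms by (subst sum.reindex) (auto simp: inj_on_def)

lemma sparse_blocks_arith_progression:
  assumes "0 < s 0" and next_start: "\<And>m. s m + l m * Suc m \<le> s (Suc m)"
  shows "sparse_blocks (\<lambda>m. arith_progression (s m) (Suc m) (l m))"
    (is "sparse_blocks ?F")
proof
  have start_mono: "s i \<le> s j" if "i \<le> j" for i j
    using that by (rule lift_Suc_mono_le [rotated]) (rule add_leD1 [OF next_start])
  have later: "x + i < y" if "i < j" "x \<in> ?F i" "y \<in> ?F j" for i j x y
  proof -
    have "x + i < s i + l i * Suc i"
      using arith_progression_add_step_le [OF that(2)] by simp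
    also have "\<dots> \<le> s (Suc i)" by (rule next_start)
    also have "\<dots> \<le> s j" using that(1) by (intro start_mono) simp
    also have "\<dots> \<le> y" using that(3) by (rule arith_progression_ge)
    finally show ?thesis .
  qed
  show "finite (?F i)" for i by (rule finite_arith_progression)
  show "?F i \<subseteq> PN" for i
    using arith_progression_ge start_mono [of 0 i] assms(1) by fastforce
  show "disjoint_family ?F"
    unfolding disjoint_family_on_def using later
    by (metis disjoint_iff linorder_neqE_nat not_add_less1)
  show "x + i < y" if xy: "x \<in> ?F i" "y \<in> ?F j" "x < y" for x y i j
  proof (cases i j rule: linorder_cases)
    case less
    then show ?thesis using xy(1,2) by (rule later)
  next
    case equal
    then show ?thesis using arith_progression_gap xy by fastforce
  next
    case greater
    then show ?thesis using later [OF _ xy(2,1)] xy(3) by fastforce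
  qed
qed

lemma ex_sparse_blocks:
  assumes "\<And>a d. 0 < a \<Longrightarrow> 0 < d \<Longrightarrow> \<exists>n. P (arith_progression a d n)"
  shows "\<exists>F. sparse_blocks F \<and> (\<forall>i. P (F i))"
proof -
  obtain len where len: "\<And>a d. 0 < a \<Longrightarrow> 0 < d \<Longrightarrow> P (arith_progression a d (len a d))"
    using assms by metis
  define start where "start = rec_nat 1 (\<lambda>m a. a + len a (Suc m) * Suc m)"
  define F where "F m = arith_progression (start m) (Suc m) (len (start m) (Suc m))" for m
  have start_Suc: "start (Suc m) = start m + len (start m) (Suc m) * Suc m" for m
    by (simp add: start_def)
  have start_pos: "0 < start m" for m
    by (induction m) (simp_all add: start_Suc, simp add: start_def)
  have "sparse_blocks F"
    unfolding F_def by (rule sparse_blocks_arith_progression) (simp_all only: start_pos start_Suc)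
  moreover have "P (F i)" for i unfolding F_def using start_pos by (intro len) simp_all
  ultimately show ?thesis by blast
qed

section \<open>Antimonotone weights\<close>

lemma not_summable_on_UNION:
  fixes f :: "'a \<Rightarrow> real"
  assumes "infinite X" "disjoint_family_on F X" "0 < c"
    and fin: "\<And>i. i \<in> X \<Longrightarrow> finite (F i)" and mass: "\<And>i. i \<in> X \<Longrightarrow> c \<le> sum f (F i)"
  shows "\<not> f summable_on \<Union>(F ` X)"
proof
  assume "f summable_on \<Union>(F ` X)"
  then have "(\<lambda>i. infsum f (F i)) summable_on X"
    using fin assms(2) by (intro summable_on_UnionD) auto
  then have "(\<lambda>_. c) summable_on X"
    by (rule summable_on_comparison_test) (use fin mass \<open>0 < c\<close> in auto)
  moreover have "\<not> (\<lambda>_. c) summable_on X"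
    using \<open>infinite X\<close> \<open>0 < c\<close> by (intro infsum_diverge_constant) auto
  ultimately show False by contradiction
qed

lemma summable_on_atLeast_iff:
  fixes f :: "nat \<Rightarrow> real"
  assumes "\<And>n. a \<le> n \<Longrightarrow> 0 \<le> f n"
  shows "f summable_on {a..} \<longleftrightarrow> summable f"
proof -
  have "bij_betw (\<lambda>n. n + a) UNIV {a..}"
    by (rule bij_betw_byWitness [where f' = "\<lambda>n. n - a"]) auto
  then have "f summable_on {a..} \<longleftrightarrow> (\<lambda>n. f (n + a)) summable_on UNIV"
    by (rule summable_on_reindex_bij_betw [symmetric])
  also have "\<dots> \<longleftrightarrow> summable (\<lambda>n. f (n + a))"
    using assms by (intro summable_on_UNIV_nonneg_real_iff) simp
  finally show ?thesis by simp
qed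

lemma summable_diff_shift:
  fixes f :: "nat \<Rightarrow> 'a::real_normed_vector"
  assumes "convergent f"
  shows "summable (\<lambda>n. f n - f (n + m))"
proof (induction m)
  case (Suc m)
  have "convergent (\<lambda>n. f (n + m))" using assms by (simp add: convergent_ignore_initial_segment)
  then have "summable (\<lambda>n. f (n + m) - f (n + Suc m))"
    using telescope_summable' [of "\<lambda>n. f (n + m)"] by (auto simp: convergent_def)
  from summable_add [OF Suc.IH this] show ?case by simp
qed simp

lemma convergent_if_nonneg_antimono_on_atLeast:
  fixes f :: "nat \<Rightarrow> real"
  assumes nonneg: "\<And>n. a \<le> n \<Longrightarrow> 0 \<le> f n" and "antimono_on {a..} f"
  shows "convergent f"
proof (rule Bseq_monoseq_convergent'_dec)
  show antimono: "f n \<le> f m" if "a \<le> m" "m \<le> n" for m n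
    using monotone_onD [OF assms(2)] that by simp
  show "Bseq (\<lambda>n. f (n + a))"
    by (rule BseqI' [of _ "f a"]) (simp add: nonneg antimono)
qed

lemma summable_on_shift_iff:
  fixes f :: "nat \<Rightarrow> real"
  assumes nonneg: "\<And>n. a \<le> n \<Longrightarrow> 0 \<le> f n" and antimono: "antimono_on {a..} f"
    and X: "X \<subseteq> {a..}"
  shows "f summable_on (\<lambda>n. n + m) ` X \<longleftrightarrow> f summable_on X"
proof -
  define g where "g n = f n - f (n + m)" for n
  have "summable g"
    unfolding g_def using convergent_if_nonneg_antimono_on_atLeast [OF nonneg antimono]
    by (rule summable_diff_shift)
  moreover have "0 \<le> g n" if "a \<le> n" for n
    using monotone_onD [OF antimono, of n "n + m"] that by (simp add: g_def)
  ultimately have "g summable_on {a..}" by (simp add: summable_on_atLeast_iff)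
  then have g: "g summable_on X" using X by (rule summable_on_subset_banach)
  have "f summable_on (\<lambda>n. n + m) ` X \<longleftrightarrow> (\<lambda>n. f (n + m)) summable_on X"
    by (subst summable_on_reindex) (auto simp: inj_on_def o_def)
  also have "\<dots> \<longleftrightarrow> f summable_on X"
  proof
    assume "(\<lambda>n. f (n + m)) summable_on X"
    from summable_on_add [OF this g] show "f summable_on X" by (simp add: g_def)
  next
    assume "f summable_on X"
    moreover have "(\<lambda>n. - g n) summable_on X" using g by (simp add: summable_on_uminus)
    ultimately have "(\<lambda>n. f n + - g n) summable_on X" by (rule summable_on_add)
    then show "(\<lambda>n. f (n + m)) summable_on X" by (simp add: g_def)
  qed
  finally show ?thesis .
qed

lemma translation_invariant_ideal_summable_ideal:
  fixes f :: "nat \<Rightarrow> real"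
  assumes nonneg: "\<And>n. n \<in> PN \<Longrightarrow> 0 \<le> f n" and antimono: "antimono_on PN f"
    and "\<not> f summable_on PN"
  shows "translation_invariant_ideal (summable_ideal f)"
proof
  show "ideal_on_PN (summable_ideal f)" using assms(3) by (rule ideal_summable_ideal)
  show "X \<in> summable_ideal f" if "finite X" "X \<subseteq> PN" for X
    using that by (simp add: summable_ideal_def)
  have shift: "f summable_on (\<lambda>n. n + m) ` X \<longleftrightarrow> f summable_on X" if "X \<subseteq> PN" for X m
    using nonneg antimono that by (intro summable_on_shift_iff [of 1]) auto
  show "translate X k \<in> summable_ideal f" if "X \<in> summable_ideal f" for X k
  proof -
    have X: "X \<subseteq> PN" "f summable_on X" using that by (auto simp: summable_ideal_def)
    have "f summable_on translate X k"
    proof (cases k rule: int_cases2)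
      case (nonneg m)
      then show ?thesis using X by (simp add: translate_int shift)
    next
      case (nonpos m)
      have "(\<lambda>n. n + m) ` translate X k \<subseteq> X" by (auto simp: nonpos translate_uminus)
      with X(2) have "f summable_on (\<lambda>n. n + m) ` translate X k"
        by (rule summable_on_subset_banach)
      then show ?thesis using shift [OF translate_subset_PN] by blast
    qed
    then show ?thesis unfolding summable_ideal_def using translate_subset_PN by blast
  qed
qed

lemma summable_if_summable_arith_progression:
  fixes f :: "nat \<Rightarrow> real"
  assumes nonneg: "\<And>n. a \<le> n \<Longrightarrow> 0 \<le> f n" and antimono: "antimono_on {a..} f"
    and "0 < d" and summable: "summable (\<lambda>j. f (a + j * d))"
  shows "summable f"
proof -
  let ?C = "\<Sum>j. f (a + j * d)"
  have "(\<Sum>k<M. f (k + a)) \<le> real d * ?C" for M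
  proof -
    have "(\<Sum>k<M. f (k + a)) \<le> (\<Sum>k<M * d. f (k + a))"
      using nonneg \<open>0 < d\<close> by (intro sum_mono2) auto
    also have "\<dots> = (\<Sum>j<M. \<Sum>k = j * d..<j * d + d. f (k + a))"
      by (rule sum.nat_group [symmetric])
    also have "\<dots> \<le> (\<Sum>j<M. \<Sum>k = j * d..<j * d + d. f (a + j * d))"
      by (intro sum_mono monotone_onD [OF antimono]) auto
    also have "\<dots> = real d * (\<Sum>j<M. f (a + j * d))"
      by (simp add: sum_distrib_left)
    also have "\<dots> \<le> real d * ?C"
      using nonneg by (intro mult_left_mono sum_le_suminf [OF summable]) auto
    finally show ?thesis .
  qed
  then have "summable (\<lambda>k. f (k + a))"
    using nonneg by (intro summableI_nonneg_bounded) auto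
  then show ?thesis by simp
qed

lemma ex_arith_progression_sum_ge:
  fixes f :: "nat \<Rightarrow> real"
  assumes nonneg: "\<And>n. a \<le> n \<Longrightarrow> 0 \<le> f n" and antimono: "antimono_on {a..} f"
    and "\<not> summable f" "0 < d"
  shows "\<exists>n. c \<le> sum f (arith_progression a d n)"
proof (rule ccontr)
  assume "\<not> ?thesis"
  then have "(\<Sum>j<n. f (a + j * d)) \<le> c" for n
    by (auto simp: sum_arith_progression [OF \<open>0 < d\<close>] not_le intro: less_imp_le)
  then have "summable (\<lambda>j. f (a + j * d))"
    using nonneg by (intro summableI_nonneg_bounded) auto
  with nonneg antimono \<open>0 < d\<close> have "summable f"
    by (rule summable_if_summable_arith_progression)
  with assms(3) show False by contradiction
qed

lemma ex_continuum_TAD_family_summable_ideal: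
  fixes f :: "nat \<Rightarrow> real"
  assumes nonneg: "\<And>n. n \<in> PN \<Longrightarrow> 0 \<le> f n" and antimono: "antimono_on PN f"
    and "\<not> f summable_on PN"
  shows "\<exists>\<A>. TAD_family (summable_ideal f) \<A> \<and> \<A> \<approx> (UNIV :: real set)"
proof -
  interpret translation_invariant_ideal "summable_ideal f"
    using assms by (rule translation_invariant_ideal_summable_ideal)
  have "\<not> summable f" using assms(3) summable_on_atLeast_iff [of 1 f] nonneg by simp
  have "\<exists>n. 1 \<le> sum f (arith_progression a d n)" if "0 < a" "0 < d" for a d
  proof (rule ex_arith_progression_sum_ge)
    show "0 \<le> f n" if "a \<le> n" for n using nonneg that \<open>0 < a\<close> by simp
    show "antimono_on {a..} f" using antimono by (rule monotone_on_subset) (use \<open>0 < a\<close> in auto)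
  qed fact+
  then obtain F where "sparse_blocks F" and mass: "\<And>i. 1 \<le> sum f (F i)"
    using ex_sparse_blocks [of "\<lambda>B. 1 \<le> sum f B"] by blast
  interpret sparse_blocks F by fact
  have "disjoint_family_on F X" for X
    using disjoint_blocks by (rule disjoint_family_on_mono [OF subset_UNIV])
  then have "\<Union>(F ` X) \<notin> summable_ideal f" if "infinite X" for X
    using not_summable_on_UNION [OF that, of F 1 f] finite_block mass
    by (simp add: summable_ideal_def)
  with \<open>sparse_blocks F\<close> show ?thesis by (rule ex_continuum_TAD_family)
qed

section \<open>The density of a chain of ideals\<close>

locale ideal_chain =
  fixes L :: "real \<Rightarrow> nat set set"
  assumes chain_ideal: "0 < r \<Longrightarrow> r < 1 \<Longrightarrow> translation_invariant_ideal (L r)"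
    and chain_mono: "r \<le> s \<Longrightarrow> L r \<subseteq> L s"
begin

lemma chain_admissible: "0 < r \<Longrightarrow> r < 1 \<Longrightarrow> admissible_ideal (L r)"
  using chain_ideal by (rule translation_invariant_ideal.axioms(1))

definition chain_density :: "nat set \<Rightarrow> real" where
  "chain_density X = Inf (insert 1 {r \<in> {0<..<1}. X \<in> L r})"

lemma bdd_below_chain_levels: "bdd_below (insert 1 {r \<in> {0<..<1}. X \<in> L r})"
  by (rule bdd_belowI [of _ 0]) auto

lemma chain_density_nonneg: "0 \<le> chain_density X"
  unfolding chain_density_def by (rule cInf_greatest) auto

lemma chain_density_le_1: "chain_density X \<le> 1"
  unfolding chain_density_def by (rule cInf_lower [OF _ bdd_below_chain_levels]) simp

lemma chain_density_le_iff:
  assumes "0 \<le> r"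
  shows "chain_density X \<le> r \<longleftrightarrow> (\<forall>s. r < s \<longrightarrow> s < 1 \<longrightarrow> X \<in> L s)"
proof (intro iffI allI impI)
  fix s assume "chain_density X \<le> r" "r < s" "s < 1"
  then have "chain_density X < s" by simp
  then obtain t where "t \<in> insert 1 {r \<in> {0<..<1}. X \<in> L r}" "t < s"
    unfolding chain_density_def cInf_less_iff [OF insert_not_empty bdd_below_chain_levels] by blast
  then show "X \<in> L s" using \<open>s < 1\<close> chain_mono [of t s] by auto
next
  assume mem: "\<forall>s. r < s \<longrightarrow> s < 1 \<longrightarrow> X \<in> L s"
  show "chain_density X \<le> r"
  proof (rule ccontr)
    assume "\<not> chain_density X \<le> r"
    then obtain s where s: "r < s" "s < chain_density X"
      using dense [of r "chain_density X"] by auto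
    then have "s \<in> {r \<in> {0<..<1}. X \<in> L r}"
      using mem assms chain_density_le_1 [of X] by simp
    then have "chain_density X \<le> s"
      unfolding chain_density_def by (intro cInf_lower bdd_below_chain_levels) simp
    then show False using s by simp
  qed
qed

lemma chain_density_lessD: "chain_density X < r \<Longrightarrow> r < 1 \<Longrightarrow> X \<in> L r"
  using chain_density_le_iff [OF chain_density_nonneg, of X X] by blast

lemma chain_density_eqI:
  assumes "0 < q" "q < 1" and mem_iff: "\<And>r. 0 < r \<Longrightarrow> r < 1 \<Longrightarrow> X \<in> L r \<longleftrightarrow> q \<le> r"
  shows "chain_density X = q"
proof (rule antisym)
  show "chain_density X \<le> q" using assms by (simp add: chain_density_le_iff)
  show "q \<le> chain_density X"
    unfolding chain_density_def using assms by (intro cInf_greatest) auto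
qed

lemma chain_density_eq_0_iff: "chain_density X = 0 \<longleftrightarrow> X \<in> (\<Inter>r\<in>{0<..<1}. L r)"
  using chain_density_le_iff [of 0 X] chain_density_nonneg [of X] by auto

lemma chain_density_PN: "chain_density PN = 1"
proof (rule antisym [OF chain_density_le_1], rule ccontr)
  assume "\<not> 1 \<le> chain_density PN"
  then obtain r where r: "chain_density PN < r" "r < 1"
    using dense [of "chain_density PN" 1] by auto
  then interpret admissible_ideal "L r"
    using chain_density_nonneg [of PN] by (intro chain_admissible) auto
  show False using chain_density_lessD [OF r] PN_notin by contradiction
qed

lemma chain_density_mono:
  assumes "X \<subseteq> Y"
  shows "chain_density X \<le> chain_density Y"
  unfolding chain_density_le_iff [OF chain_density_nonneg]
proof (intro allI impI)
  fix r assume r: "chain_density Y < r" "r < 1"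
  then interpret admissible_ideal "L r"
    using chain_density_nonneg [of Y] by (intro chain_admissible) auto
  show "X \<in> L r" using chain_density_lessD [OF r] assms by (rule mem_subset)
qed

lemma chain_density_Un: "chain_density (X \<union> Y) \<le> max (chain_density X) (chain_density Y)"
proof -
  have "X \<union> Y \<in> L r" if r: "max (chain_density X) (chain_density Y) < r" "r < 1" for r
  proof -
    interpret admissible_ideal "L r"
      using r chain_density_nonneg [of X] by (intro chain_admissible) auto
    show ?thesis using r by (intro mem_Un chain_density_lessD) auto
  qed
  moreover have "0 \<le> max (chain_density X) (chain_density Y)"
    using chain_density_nonneg [of X] by linarith
  ultimately show ?thesis using chain_density_le_iff by blast
qed

lemma chain_density_translate:
  assumes "X \<subseteq> PN"
  shows "chain_density (translate X k) = chain_density X"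
proof -
  have "translate X k \<in> L r \<longleftrightarrow> X \<in> L r" if "0 < r" "r < 1" for r
    using translation_invariant_ideal.translate_mem_iff [OF chain_ideal [OF that] assms] .
  then have "{r \<in> {0<..<1}. translate X k \<in> L r} = {r \<in> {0<..<1}. X \<in> L r}" by auto
  then show ?thesis by (simp only: chain_density_def)
qed

lemma abstract_upper_density_chain_density: "abstract_upper_density chain_density"
  unfolding abstract_upper_density_def
proof (intro conjI allI impI)
  show "chain_density X \<in> {0..1}" for X
    using chain_density_nonneg chain_density_le_1 by simp
  show "chain_density PN = 1" by (rule chain_density_PN)
  show "chain_density F = 0" if "F \<subseteq> PN" "finite F" for F
    unfolding chain_density_eq_0_iff
    using admissible_ideal.finite_mem [OF chain_admissible that(2,1)] by simp
  show "chain_density X \<le> chain_density Y" if "X \<subseteq> Y" for X Y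
    using that by (rule chain_density_mono)
  show "chain_density (X \<union> Y) \<le> chain_density X + chain_density Y" for X Y
    using chain_density_Un [of X Y] chain_density_nonneg [of X] chain_density_nonneg [of Y]
    by linarith
qed

lemma translation_invariant_chain_density: "translation_invariant chain_density"
  unfolding translation_invariant_def translate_uminus [symmetric]
  by (simp add: chain_density_translate)

lemma zero_ideal_chain_density: "zero_ideal chain_density = (\<Inter>r\<in>{0<..<1}. L r)"
proof -
  have "X \<subseteq> PN" if "X \<in> (\<Inter>r\<in>{0<..<1}. L r)" for X
    using that admissible_ideal.mem_subset_PN [OF chain_admissible [of "1/2"]] by simp
  then show ?thesis by (auto simp only: zero_ideal_def chain_density_eq_0_iff)
qed

lemma rich_chain_density:
  assumes "\<And>q. 0 < q \<Longrightarrow> q < 1 \<Longrightarrow> \<exists>X\<subseteq>PN. \<forall>r. 0 < r \<longrightarrow> r < 1 \<longrightarrow> (X \<in> L r \<longleftrightarrow> q \<le> r)"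
  shows "rich chain_density"
  unfolding rich_def
proof
  fix q :: real assume "q \<in> {0..1}"
  then consider (zero) "q = 0" | (one) "q = 1" | (between) "0 < q" "q < 1"
    unfolding atLeastAtMost_iff by linarith
  then show "\<exists>X. X \<subseteq> PN \<and> chain_density X = q"
  proof cases
    case zero
    have "chain_density {} = 0"
      using abstract_upper_density_chain_density by (simp add: abstract_upper_density_def)
    then show ?thesis using zero by blast
  next
    case one
    then show ?thesis using chain_density_PN by blast
  next
    case between
    then obtain X where "X \<subseteq> PN" "\<And>r. 0 < r \<Longrightarrow> r < 1 \<Longrightarrow> X \<in> L r \<longleftrightarrow> q \<le> r"
      using assms by blast
    then show ?thesis using chain_density_eqI [OF between] by blast
  qed
qed

end

section \<open>Ideals generated by translates\<close>

context admissible_ideal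
begin

definition generated_ideal :: "nat set set \<Rightarrow> nat set set" where
  "generated_ideal \<G> = {X. X \<subseteq> PN \<and> (\<exists>\<F>. finite \<F> \<and> \<F> \<subseteq> \<G> \<and> X - \<Union>\<F> \<in> I)}"

lemma generated_idealI:
  "X \<subseteq> PN \<Longrightarrow> finite \<F> \<Longrightarrow> \<F> \<subseteq> \<G> \<Longrightarrow> X - \<Union>\<F> \<in> I \<Longrightarrow> X \<in> generated_ideal \<G>"
  unfolding generated_ideal_def by blast

lemma generated_idealE:
  assumes "X \<in> generated_ideal \<G>"
  obtains \<F> where "X \<subseteq> PN" "finite \<F>" "\<F> \<subseteq> \<G>" "X - \<Union>\<F> \<in> I"
  using assms unfolding generated_ideal_def by blast

lemma generated_ideal_mono: "\<G> \<subseteq> \<H> \<Longrightarrow> generated_ideal \<G> \<subseteq> generated_ideal \<H>"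
  unfolding generated_ideal_def by blast

lemma subset_generated_ideal: "I \<subseteq> generated_ideal \<G>"
proof
  show "X \<in> generated_ideal \<G>" if "X \<in> I" for X
    using that mem_subset_PN [OF that] by (intro generated_idealI [of X "{}"]) simp_all
qed

lemma generator_mem: "G \<in> \<G> \<Longrightarrow> G \<subseteq> PN \<Longrightarrow> G \<in> generated_ideal \<G>"
  by (rule generated_idealI [of _ "{G}"]) (auto intro: finite_mem)

lemma generated_ideal_subset:
  assumes "X \<in> generated_ideal \<G>" "Y \<subseteq> X"
  shows "Y \<in> generated_ideal \<G>"
  using assms(1)
proof (rule generated_idealE)
  fix \<F> assume \<F>: "X \<subseteq> PN" "finite \<F>" "\<F> \<subseteq> \<G>" "X - \<Union>\<F> \<in> I"
  have "Y - \<Union>\<F> \<in> I" using \<F>(4) by (rule mem_subset) (use assms(2) in blast)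
  with \<F> assms(2) show ?thesis by (intro generated_idealI [of Y \<F>]) auto
qed

lemma generated_ideal_Un:
  assumes "X \<in> generated_ideal \<G>" "Y \<in> generated_ideal \<G>"
  shows "X \<union> Y \<in> generated_ideal \<G>"
proof -
  obtain \<F>\<^sub>X where X: "X \<subseteq> PN" "finite \<F>\<^sub>X" "\<F>\<^sub>X \<subseteq> \<G>" "X - \<Union>\<F>\<^sub>X \<in> I"
    using assms(1) by (rule generated_idealE)
  obtain \<F>\<^sub>Y where Y: "Y \<subseteq> PN" "finite \<F>\<^sub>Y" "\<F>\<^sub>Y \<subseteq> \<G>" "Y - \<Union>\<F>\<^sub>Y \<in> I"
    using assms(2) by (rule generated_idealE)
  have "X \<union> Y - \<Union>(\<F>\<^sub>X \<union> \<F>\<^sub>Y) \<in> I"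
    by (rule mem_subset [OF mem_Un [OF X(4) Y(4)]]) blast
  then show ?thesis using X Y by (intro generated_idealI [of _ "\<F>\<^sub>X \<union> \<F>\<^sub>Y"]) auto
qed

lemma admissible_ideal_generated_ideal:
  assumes "PN \<notin> generated_ideal \<G>"
  shows "admissible_ideal (generated_ideal \<G>)"
proof
  show finite_mem_generated: "X \<in> generated_ideal \<G>" if "finite X" "X \<subseteq> PN" for X
    using finite_mem [OF that] subset_generated_ideal by blast
  have "generated_ideal \<G> \<subseteq> Pow PN" unfolding generated_ideal_def by blast
  moreover have "generated_ideal \<G> \<noteq> {}" using finite_mem_generated [of "{}"] by auto
  ultimately show "ideal_on_PN (generated_ideal \<G>)"
    unfolding ideal_on_PN_def
    using assms generated_ideal_subset generated_ideal_Un by blast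
qed

lemma generated_ideal_Int_subset:
  assumes orth: "\<And>G H. G \<in> \<G> \<Longrightarrow> H \<in> \<H> \<Longrightarrow> G \<inter> H \<in> I"
  shows "generated_ideal \<G> \<inter> generated_ideal \<H> \<subseteq> I"
proof
  fix X assume "X \<in> generated_ideal \<G> \<inter> generated_ideal \<H>"
  then obtain \<F> \<E> where \<F>: "finite \<F>" "\<F> \<subseteq> \<G>" "X - \<Union>\<F> \<in> I"
    and \<E>: "finite \<E>" "\<E> \<subseteq> \<H>" "X - \<Union>\<E> \<in> I"
    by (auto elim!: generated_idealE)
  have "(\<Union>G\<in>\<F>. \<Union>H\<in>\<E>. G \<inter> H) \<in> I"
    using \<F> \<E> orth by (intro mem_UN) auto
  with \<F>(3) \<E>(3) have "(X - \<Union>\<F>) \<union> (X - \<Union>\<E>) \<union> (\<Union>G\<in>\<F>. \<Union>H\<in>\<E>. G \<inter> H) \<in> I"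
    by (intro mem_Un)
  then show "X \<in> I" by (rule mem_subset) blast
qed

end

lemma (in translation_invariant_ideal) translation_invariant_ideal_generated_ideal:
  assumes "PN \<notin> generated_ideal \<G>"
    and translate_generator: "\<And>G k. G \<in> \<G> \<Longrightarrow> \<exists>H\<in>\<G>. translate G k \<subseteq> H"
  shows "translation_invariant_ideal (generated_ideal \<G>)"
proof (intro translation_invariant_ideal.intro translation_invariant_ideal_axioms.intro)
  show "admissible_ideal (generated_ideal \<G>)"
    using assms(1) by (rule admissible_ideal_generated_ideal)
  fix X k assume "X \<in> generated_ideal \<G>"
  then obtain \<F> where \<F>: "finite \<F>" "\<F> \<subseteq> \<G>" "X - \<Union>\<F> \<in> I" by (rule generated_idealE)
  have "\<forall>G\<in>\<F>. \<exists>H. H \<in> \<G> \<and> translate G k \<subseteq> H" using translate_generator \<F>(2) by blast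
  from bchoice [OF this] obtain h where h: "\<And>G. G \<in> \<F> \<Longrightarrow> h G \<in> \<G> \<and> translate G k \<subseteq> h G"
    by blast
  have "translate X k \<subseteq> translate (X - \<Union>\<F>) k \<union> translate (\<Union>\<F>) k"
    unfolding translate_Un [symmetric] by (rule translate_mono) blast
  also have "translate (\<Union>\<F>) k \<subseteq> \<Union>(h ` \<F>)" using h by (auto simp: translate_Union)
  finally have "translate X k - \<Union>(h ` \<F>) \<subseteq> translate (X - \<Union>\<F>) k" by blast
  then have "translate X k - \<Union>(h ` \<F>) \<in> I" by (rule mem_subset [OF translate_mem [OF \<F>(3)]])
  then show "translate X k \<in> generated_ideal \<G>"
    using h \<F>(1) translate_subset_PN by (intro generated_idealI [of _ "h ` \<F>"]) auto
qed

locale indexed_TAD_family = translation_invariant_ideal +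
  fixes A :: "real \<Rightarrow> nat set"
  assumes A_subset_PN: "A q \<subseteq> PN"
    and A_notin: "A q \<notin> I"
    and A_TAD: "p \<noteq> q \<Longrightarrow> TAD I (A p) (A q)"
begin

definition translates :: "real \<Rightarrow> nat set set" where
  "translates r = (\<lambda>(q, s). translate (A q) s) ` ({0<..r} \<times> UNIV)"

definition level :: "real \<Rightarrow> nat set set" where
  "level r = generated_ideal (translates r)"

lemma level_mono: "r \<le> s \<Longrightarrow> level r \<subseteq> level s"
  unfolding level_def translates_def by (intro generated_ideal_mono image_mono) auto

lemma translates_Int_mem: "p \<noteq> q \<Longrightarrow> translate (A p) s \<inter> translate (A q) t \<in> I"
  using A_TAD unfolding TAD_def by blast

lemma A_mem_level_iff:
  assumes "0 < q"
  shows "A q \<in> level r \<longleftrightarrow> q \<le> r"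
proof
  have translate_A: "translate (A q) 0 = A q" using A_subset_PN by (rule translate_0)
  show "A q \<in> level r" if "q \<le> r"
    unfolding level_def
  proof (rule generator_mem)
    have "(q, 0) \<in> {0<..r} \<times> UNIV" using assms that by simp
    then show "A q \<in> translates r" unfolding translates_def using translate_A by force
  qed (rule A_subset_PN)
  show "q \<le> r" if "A q \<in> level r"
  proof (rule ccontr)
    assume "\<not> q \<le> r"
    have "A q \<inter> H \<in> I" if H: "H \<in> translates r" for H
    proof -
      obtain p s where "p \<le> r" "H = translate (A p) s"
        using H by (auto simp: translates_def)
      then show ?thesis using translates_Int_mem [of q p 0 s] \<open>\<not> q \<le> r\<close> translate_A by auto
    qed
    then have "G \<inter> H \<in> I" if "G \<in> {A q}" "H \<in> translates r" for G H using that by simp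
    then have "generated_ideal {A q} \<inter> level r \<subseteq> I"
      unfolding level_def by (rule generated_ideal_Int_subset)
    moreover have "A q \<in> generated_ideal {A q}" using A_subset_PN by (simp add: generator_mem)
    ultimately show False using that A_notin by blast
  qed
qed

lemma translation_invariant_ideal_level: "translation_invariant_ideal (level r)"
  unfolding level_def
proof (rule translation_invariant_ideal_generated_ideal)
  define q where "q = max r 0 + 1"
  have "A q \<notin> level r" using A_mem_level_iff [of q r] by (simp add: q_def)
  then show "PN \<notin> generated_ideal (translates r)"
    unfolding level_def using A_subset_PN generated_ideal_subset by blast
  show "\<exists>H\<in>translates r. translate G k \<subseteq> H" if "G \<in> translates r" for G k
    using that translate_translate_subset unfolding translates_def by fastforce
qed

lemma ex_smaller_translates_Int_mem:
  assumes "finite \<F>" "\<F> \<subseteq> translates r"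
  obtains e where "0 < e" "e < 1" "\<And>G H. G \<in> \<F> \<Longrightarrow> H \<in> translates e \<Longrightarrow> G \<inter> H \<in> I"
proof -
  obtain P where P: "P \<subseteq> {0<..r} \<times> UNIV" "finite P" "\<F> = (\<lambda>(q, s). translate (A q) s) ` P"
    using finite_subset_image [OF assms(1) assms(2) [unfolded translates_def]] by blast
  have "0 < Min (insert 1 (fst ` P))" using P(1,2) by (subst Min_gr_iff) auto
  then obtain e where e: "0 < e" "e < Min (insert 1 (fst ` P))"
    using dense [of 0 "Min (insert 1 (fst ` P))"] by auto
  then have "e < 1" and less: "\<And>p. p \<in> P \<Longrightarrow> e < fst p" using P(2) by simp_all
  have "G \<inter> H \<in> I" if GH: "G \<in> \<F>" "H \<in> translates e" for G H
  proof -
    obtain p s where p: "(p, s) \<in> P" "G = translate (A p) s" using GH(1) P(3) by auto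
    obtain q t where "q \<le> e" "H = translate (A q) t"
      using GH(2) by (auto simp: translates_def)
    with p less [OF p(1)] show ?thesis by (simp add: translates_Int_mem)
  qed
  with e(1) \<open>e < 1\<close> show thesis by (rule that)
qed

lemma Inter_level: "(\<Inter>r\<in>{0<..<1}. level r) = I"
proof
  show "I \<subseteq> (\<Inter>r\<in>{0<..<1}. level r)" using subset_generated_ideal by (auto simp: level_def)
  show "(\<Inter>r\<in>{0<..<1}. level r) \<subseteq> I"
  proof
    fix X assume X: "X \<in> (\<Inter>r\<in>{0<..<1}. level r)"
    then have "X \<in> level (1/2)" by simp
    then obtain \<F> where \<F>: "X \<subseteq> PN" "finite \<F>" "\<F> \<subseteq> translates (1/2)" "X - \<Union>\<F> \<in> I"
      unfolding level_def by (rule generated_idealE)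
    obtain e where e: "0 < e" "e < 1" "\<And>G H. G \<in> \<F> \<Longrightarrow> H \<in> translates e \<Longrightarrow> G \<inter> H \<in> I"
      using ex_smaller_translates_Int_mem [OF \<F>(2,3)] by blast
    have "X \<in> generated_ideal \<F>" using \<F> by (intro generated_idealI [of X \<F>]) auto
    moreover have "X \<in> generated_ideal (translates e)" using X e by (simp add: level_def)
    moreover have "generated_ideal \<F> \<inter> generated_ideal (translates e) \<subseteq> I"
      using e(3) by (rule generated_ideal_Int_subset)
    ultimately show "X \<in> I" by blast
  qed
qed

sublocale ideal_chain level
  by (intro ideal_chain.intro translation_invariant_ideal_level level_mono)

end

lemma (in translation_invariant_ideal) ex_rich_density:
  assumes \<A>: "TAD_family I \<A>" "\<A> \<approx> (UNIV :: real set)"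
  shows "\<exists>\<delta>. abstract_upper_density \<delta> \<and> translation_invariant \<delta> \<and> rich \<delta> \<and> zero_ideal \<delta> = I"
proof -
  obtain A :: "real \<Rightarrow> nat set" where A: "bij_betw A UNIV \<A>"
    using eqpoll_sym [OF \<A>(2)] unfolding eqpoll_def by blast
  have A_mem: "A q \<in> \<A>" for q using A by (auto simp: bij_betw_def)
  interpret indexed_TAD_family I A
  proof
    show "A q \<subseteq> PN" "A q \<notin> I" for q
      using \<A>(1) A_mem [of q] by (auto simp: TAD_family_def)
    show "TAD I (A p) (A q)" if "p \<noteq> q" for p q
      using \<A>(1) A_mem that A by (auto simp: TAD_family_def bij_betw_def inj_eq)
  qed
  have "rich chain_density"
    using A_mem_level_iff A_subset_PN by (intro rich_chain_density) blast
  moreover have "zero_ideal chain_density = I"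
    using zero_ideal_chain_density Inter_level by simp
  ultimately show ?thesis
    using abstract_upper_density_chain_density translation_invariant_chain_density by blast
qed

theorem theorem2p2:
  fixes f :: "nat \<Rightarrow> real"
  assumes "\<forall>n\<in>PN. 0 \<le> f n"
    and "antimono_on PN f"
    and "\<not> f summable_on PN"
  shows "(\<exists>\<A>. TAD_family (summable_ideal f) \<A> \<and> \<A> \<approx> (UNIV :: real set)) \<and>
         (\<exists>\<delta>. abstract_upper_density \<delta> \<and> translation_invariant \<delta> \<and> rich \<delta> \<and>
              zero_ideal \<delta> = summable_ideal f)"
proof -
  have nonneg: "\<And>n. n \<in> PN \<Longrightarrow> 0 \<le> f n" using assms(1) by blast
  interpret translation_invariant_ideal "summable_ideal f"
    using nonneg assms(2,3) by (rule translation_invariant_ideal_summable_ideal)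
  obtain \<A> where \<A>: "TAD_family (summable_ideal f) \<A>" "\<A> \<approx> (UNIV :: real set)"
    using ex_continuum_TAD_family_summable_ideal [OF nonneg assms(2,3)] by blast
  then show ?thesis using ex_rich_density [OF \<A>] by blast
qed

end
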